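(* Each of the semirings $\mathbb{N}_{\min}$, $\mathbb{N}_{\max}$, $\bar{\mathbb{N}}_{\max}$, $\mathscr{L}$, $\mathbb{N}$, and $\bar{\mathbb{N}}$ is effectively separated by morphisms of finite image.
   Context: The semirings are (first operation is the semiring addition, second is the semiring multiplication): - $\mathbb{N}_{\min}=(\mathbb{N}\cup\{+\infty\},\min,+)$; - $\mathbb{N}_{\max}=(\mathbb{N}\cup\{-\infty\},\max,+)$; - $\bar{\mathbb{N}}_{\max}=(\mathbb{N}\cup\{\pm\infty\},\max,+)$, with the convention $(+\infty)+(-\infty)=(-\infty)+(+\infty)=-\infty$; - $\mathscr{L}=(\mathbb{N}\cup\{\omega,+\infty\},\min,+)$, where the minimum is taken with respect to the order $0<1<2<\cdots<\omega<+\infty$, and the addition of $\mathbb{N}_{\min}$ is completed by $\omega+a=a+\omega=\max(a,\omega)$; - $\mathbb{N}=(\mathbb{N},+,\times)$; - $\bar{\mathbb{N}}=(\mathbb{N}\cup\{+\infty\},+,\times)$, with the convention $0\times(+\infty)=(+\infty)\times0=0$. A semiring $\mathscr{S}$ is separated by morphisms of finite image if for all $\gamma\in\mathscr{S}$ there is a finite semiring $\mathscr{S}_\gamma$ and a semiring morphism $\pi_\gamma:\mathscr{S}\to\mathscr{S}_\gamma$ such that $\pi_\gamma^{-1}(\pi_\gamma(\gamma))=\{\gamma\}$. It is effectively separated by morphisms of finite image if moreover the maps $\gamma\mapsto\mathscr{S}_\gamma$ and $\gamma\mapsto\pi_\gamma$ are effective: for any $\gamma\in\mathscr{S}$ one can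 compute the finite set of elements of $\mathscr{S}_\gamma$ together with its addition and multiplication tables, and one can compute $\pi_\gamma(y)$ for any $y\in\mathscr{S}$. *)

theory Defs
  imports
    "HOL-Algebra.Ring"
    "HOL-Library.Extended"
    "HOL-Library.Extended_Nat"
    "HOL-Library.Nat_Bijection"
begin

no_notation Pinf (\<open>\<infinity>\<close>) and Minf (\<open>-\<infinity>\<close>)

section \<open>Partial recursive functions\<close>

datatype recf =
    RZero
  | RSucc
  | RProj nat
  | RComp recf "recf list"
  | RPrim recf recf
  | RMin recf

text \<open>\<open>computes p xs y\<close> means that the program \<open>p\<close> halts on the arguments \<open>xs\<close> with value \<open>y\<close>.\<close>

inductive computes :: "recf \<Rightarrow> nat list \<Rightarrow> nat \<Rightarrow> bool" where
  zero: "computes RZero xs 0"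
| succ: "computes RSucc (x # xs) (Suc x)"
| proj: "i < length xs \<Longrightarrow> computes (RProj i) xs (xs ! i)"
| comp: "list_all2 (\<lambda>g y. computes g xs y) gs ys \<Longrightarrow> computes f ys z
         \<Longrightarrow> computes (RComp f gs) xs z"
| prim_0: "computes f xs y \<Longrightarrow> computes (RPrim f g) (0 # xs) y"
| prim_Suc: "computes (RPrim f g) (n # xs) y \<Longrightarrow> computes g (n # y # xs) z
         \<Longrightarrow> computes (RPrim f g) (Suc n # xs) z"
| min: "computes f (n # xs) 0 \<Longrightarrow> \<forall>i<n. \<exists>y. computes f (i # xs) (Suc y)
         \<Longrightarrow> computes (RMin f) xs n"

inductive_cases computes_RZeroE: "computes RZero xs y"
inductive_cases computes_RSuccE: "computes RSucc xs y"
inductive_cases computes_RProjE: "computes (RProj i) xs y"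
inductive_cases computes_RCompE: "computes (RComp f gs) xs y"
inductive_cases computes_RPrim_0E: "computes (RPrim f g) (0 # xs) y"
inductive_cases computes_RPrim_SucE: "computes (RPrim f g) (Suc n # xs) y"
inductive_cases computes_RMinE: "computes (RMin f) xs y"

lemma computes_deterministic:
  "computes p xs y \<Longrightarrow> computes p xs z \<Longrightarrow> y = z"
proof (induction arbitrary: z rule: computes.induct)
  case (zero xs)
  then show ?case by (rule computes_RZeroE) simp
next
  case (succ x xs)
  then show ?case by (rule computes_RSuccE) simp
next
  case (proj i xs)
  from proj.prems show ?case by (rule computes_RProjE) simp
next
  case (comp xs gs ys f w)
  from comp.prems obtain ys' where
    1: "list_all2 (\<lambda>g y. computes g xs y) gs ys'" and 2: "computes f ys' z"
    by (rule computes_RCompE)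
  have "ys = ys'"
    using comp.IH(1) 1
    by (auto simp: list_all2_conv_all_nth intro!: nth_equalityI)
  with 2 comp.IH(2) show ?case by blast
next
  case (prim_0 f xs y g)
  from prim_0.prems have "computes f xs z" by (rule computes_RPrim_0E)
  then show ?case by (rule prim_0.IH)
next
  case (prim_Suc f g n xs y w)
  from prim_Suc.prems obtain y' where
    1: "computes (RPrim f g) (n # xs) y'" and 2: "computes g (n # y' # xs) z"
    by (rule computes_RPrim_SucE)
  from prim_Suc.IH(1)[OF 1] 2 have "computes g (n # y # xs) z" by simp
  then show ?case by (rule prim_Suc.IH(2))
next
  case (min f n xs)
  from min.prems have
    1: "computes f (z # xs) 0" and 2: "\<forall>i<z. \<exists>y. computes f (i # xs) (Suc y)"
    by (rule computes_RMinE, simp)+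
  have "\<not> n < z"
    using 2 min.IH(1) by (metis nat.distinct(1))
  moreover have "\<not> z < n"
    using 1 min.IH(2) by (metis nat.distinct(1))
  ultimately show ?case by simp
qed

section \<open>Separation by morphisms of finite image\<close>

text \<open>The constant \<^const>\<open>ring_hom\<close> does not ask for \<open>\<zero>\<close> to be preserved. This is automatic for
  rings, but not for semirings.\<close>

definition semiring_hom ::
  "('a, 'm) ring_scheme \<Rightarrow> ('b, 'n) ring_scheme \<Rightarrow> ('a \<Rightarrow> 'b) set" where
  "semiring_hom R S = {h \<in> ring_hom R S. h \<zero>\<^bsub>R\<^esub> = \<zero>\<^bsub>S\<^esub>}"

definition separates_at ::
  "('a, 'm) ring_scheme \<Rightarrow> 'a \<Rightarrow> ('b, 'n) ring_scheme \<Rightarrow> ('a \<Rightarrow> 'b) \<Rightarrow> bool" where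
  "separates_at S c T h \<longleftrightarrow>
     semiring T \<and> finite (carrier T) \<and> h \<in> semiring_hom S T \<and>
     {x \<in> carrier S. h x = h c} = {c}"

text \<open>The number coding the table of a binary operation on a finite set of natural numbers, that
  is, the finite set of all triples \<open>((a, b), f a b)\<close>.\<close>

definition table_encode :: "nat set \<Rightarrow> (nat \<Rightarrow> nat \<Rightarrow> nat) \<Rightarrow> nat" where
  "table_encode A f =
     set_encode ((\<lambda>(a, b). prod_encode (prod_encode (a, b), f a b)) ` (A \<times> A))"

text \<open>Algorithms take elements of the semiring as input through the coding \<open>code\<close>; the elements
  of the finite semirings \<open>T c\<close> are themselves natural numbers. Each algorithm is uniform in the
  element \<open>c\<close> that is to be separated.\<close>

definition effectively_separated ::
  "('a, 'm) ring_scheme \<Rightarrow> ('a \<Rightarrow> nat) \<Rightarrow> bool" where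
  "effectively_separated S code \<longleftrightarrow>
     semiring S \<and> inj_on code (carrier S) \<and>
     (\<exists>(T :: 'a \<Rightarrow> nat ring) (h :: 'a \<Rightarrow> 'a \<Rightarrow> nat).
        (\<forall>c \<in> carrier S. separates_at S c (T c) (h c)) \<and>
        (\<exists>p. \<forall>c \<in> carrier S. computes p [code c] (set_encode (carrier (T c)))) \<and>
        (\<exists>p. \<forall>c \<in> carrier S. computes p [code c] (table_encode (carrier (T c)) (add (T c)))) \<and>
        (\<exists>p. \<forall>c \<in> carrier S. computes p [code c] (table_encode (carrier (T c)) (mult (T c)))) \<and>
        (\<exists>p. \<forall>c \<in> carrier S. \<forall>x \<in> carrier S. computes p [code c, code x] (h c x)))"

section \<open>The semirings\<close>

definition N_min :: "enat ring" where
  "N_min = \<lparr>carrier = UNIV, monoid.mult = (+), one = 0, ring.zero = \<infinity>, add = min\<rparr>"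

definition N_max :: "nat extended ring" where
  "N_max = \<lparr>carrier = UNIV - {Pinf}, monoid.mult = (+), one = Fin 0, ring.zero = Minf, add = max\<rparr>"

text \<open>The library defines \<^term>\<open>Pinf + Minf\<close> as \<^term>\<open>Pinf\<close>, whereas \<^term>\<open>Minf\<close> has to be
  absorbing here.\<close>

definition plus_bar :: "nat extended \<Rightarrow> nat extended \<Rightarrow> nat extended" where
  "plus_bar a b = (if a = Minf \<or> b = Minf then Minf else a + b)"

definition N_max_bar :: "nat extended ring" where
  "N_max_bar = \<lparr>carrier = UNIV, monoid.mult = plus_bar, one = Fin 0, ring.zero = Minf, add = max\<rparr>"

datatype lnat = LFin nat | LOmega | LInfty

instantiation lnat :: linorder
begin

fun less_eq_lnat :: "lnat \<Rightarrow> lnat \<Rightarrow> bool" where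
  "LFin m \<le> LFin n \<longleftrightarrow> m \<le> n"
| "LFin m \<le> LOmega \<longleftrightarrow> True"
| "LOmega \<le> LFin n \<longleftrightarrow> False"
| "LOmega \<le> LOmega \<longleftrightarrow> True"
| "a \<le> LInfty \<longleftrightarrow> True"
| "LInfty \<le> b \<longleftrightarrow> b = LInfty"

definition less_lnat :: "lnat \<Rightarrow> lnat \<Rightarrow> bool" where
  "a < b \<longleftrightarrow> a \<le> b \<and> \<not> b \<le> (a :: lnat)"

instance
proof
  fix x y z :: lnat
  show "x < y \<longleftrightarrow> x \<le> y \<and> \<not> y \<le> x" by (rule less_lnat_def)
  show "x \<le> x" by (cases x) auto
  show "x \<le> y \<Longrightarrow> y \<le> z \<Longrightarrow> x \<le> z" by (cases x; cases y; cases z) auto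
  show "x \<le> y \<Longrightarrow> y \<le> x \<Longrightarrow> x = y" by (cases x; cases y) auto
  show "x \<le> y \<or> y \<le> x" by (cases x; cases y) auto
qed

end

fun plus_lnat :: "lnat \<Rightarrow> lnat \<Rightarrow> lnat" where
  "plus_lnat (LFin m) (LFin n) = LFin (m + n)"
| "plus_lnat LOmega a = max a LOmega"
| "plus_lnat a LOmega = max a LOmega"
| "plus_lnat (LFin m) LInfty = LInfty"
| "plus_lnat LInfty (LFin n) = LInfty"
| "plus_lnat LInfty LInfty = LInfty"

definition L_semiring :: "lnat ring" where
  "L_semiring =
     \<lparr>carrier = UNIV, monoid.mult = plus_lnat, one = LFin 0, ring.zero = LInfty, add = min\<rparr>"

definition N_nat :: "nat ring" where
  "N_nat = \<lparr>carrier = UNIV, monoid.mult = (*), one = 1, ring.zero = 0, add = (+)\<rparr>"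

definition N_bar :: "enat ring" where
  "N_bar = \<lparr>carrier = UNIV, monoid.mult = (*), one = 1, ring.zero = 0, add = (+)\<rparr>"

section \<open>Codings of the elements\<close>

definition code_enat :: "enat \<Rightarrow> nat" where
  "code_enat a = (case a of enat n \<Rightarrow> Suc n | \<infinity> \<Rightarrow> 0)"

definition code_extended :: "nat extended \<Rightarrow> nat" where
  "code_extended a = (case a of Fin n \<Rightarrow> n + 2 | Pinf \<Rightarrow> 1 | Minf \<Rightarrow> 0)"

definition code_lnat :: "lnat \<Rightarrow> nat" where
  "code_lnat a = (case a of LFin n \<Rightarrow> n + 2 | LOmega \<Rightarrow> 1 | LInfty \<Rightarrow> 0)"

end

theory Submission
  imports Defs
begin

text \<open>
  Number the elements of a semiring so that a few infinite elements come first and the finite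
  elements follow in increasing order. To separate \<open>c\<close>, truncate the numbering at \<open>m = code c + 3\<close>:
  all elements whose number is at least \<open>m\<close> are identified, that is, all sufficiently large finite
  elements become one, while the infinite elements stay apart. In each of the semirings considered,
  the class of a sum or product of a large element does not depend on which large element is
  taken, so truncation is a congruence; the quotient is the finite semiring on \<open>{0..m}\<close> whose
  operations are those of the codes, cut off at \<open>m\<close>. Since \<open>code c < m\<close>, the class of \<open>c\<close> is a
  singleton. This is \<open>effectively_separated_by_truncation\<close>.

  Effectiveness comes for free: the quotient depends on \<open>c\<close> only through \<open>m\<close>, its operations are
  primitive recursive in \<open>m\<close> and the arguments, and the number coding a table over \<open>{0..m}\<close> is a
  bounded double sum of powers of two (\<open>recursive_table_encode\<close>).

  Truncation is carried out for \<open>L_semiring\<close>, \<open>N_max_bar\<close> and \<open>N_bar\<close>. Each of the other three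
  embeds into one of these by a map that is computable on codes, and a separating morphism restricts
  along such an embedding (\<open>effectively_separated_embedding\<close>).
\<close>

section \<open>Total recursive functions\<close>

definition recursive :: "nat \<Rightarrow> (nat list \<Rightarrow> nat) \<Rightarrow> bool" where
  "recursive k f \<longleftrightarrow> (\<exists>p. \<forall>xs. length xs = k \<longrightarrow> computes p xs (f xs))"

lemma recursive_cong:
  assumes "recursive k f" "\<And>xs. length xs = k \<Longrightarrow> g xs = f xs"
  shows "recursive k g"
  using assms unfolding recursive_def by auto

lemma recursive_nth: "i < k \<Longrightarrow> recursive k (\<lambda>xs. xs ! i)"
  unfolding recursive_def by (auto intro!: exI[of _ "RProj i"] computes.proj)

lemma recursive_comp:
  assumes g: "recursive (length fs) g" and fs: "\<forall>f\<in>set fs. recursive k f"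
  shows "recursive k (\<lambda>xs. g (map (\<lambda>f. f xs) fs))"
proof -
  from g obtain pg where pg: "\<And>xs. length xs = length fs \<Longrightarrow> computes pg xs (g xs)"
    unfolding recursive_def by blast
  from fs obtain P where P: "\<And>f xs. f \<in> set fs \<Longrightarrow> length xs = k \<Longrightarrow> computes (P f) xs (f xs)"
    unfolding recursive_def by metis
  have "computes (RComp pg (map P fs)) xs (g (map (\<lambda>f. f xs) fs))" if "length xs = k" for xs
    using that P pg by (intro computes.comp[of xs _ "map (\<lambda>f. f xs) fs"])
      (auto simp: list_all2_conv_all_nth)
  then show ?thesis unfolding recursive_def by blast
qed

text \<open>The next two forms turn a function known to be recursive in its bare arguments into a closure
  rule for \<open>recursive k\<close>.\<close>

lemma recursive_comp1:
  assumes "recursive (Suc 0) (\<lambda>xs. g (xs ! 0))" "recursive k f"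
  shows "recursive k (\<lambda>xs. g (f xs))"
  using recursive_comp[of "[f]" "\<lambda>xs. g (xs ! 0)" k] assms by simp

lemma recursive_comp2:
  assumes "recursive 2 (\<lambda>xs. g (xs ! 0) (xs ! 1))" "recursive k f" "recursive k f'"
  shows "recursive k (\<lambda>xs. g (f xs) (f' xs))"
  using recursive_comp[of "[f, f']" "\<lambda>xs. g (xs ! 0) (xs ! 1)" k] assms
  by (simp add: numeral_2_eq_2)

lemma recursive_reindex:
  assumes "recursive (length is) f" "\<forall>i\<in>set is. i < k"
  shows "recursive k (\<lambda>xs. f (map (\<lambda>i. xs ! i) is))"
  using recursive_comp[of "map (\<lambda>i xs. xs ! i) is" f k] assms
  by (simp add: recursive_nth comp_def)

text \<open>Dropping the head is weakening: under a bounded sum or a recursion the bound variable is pushed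
  in front of the arguments, and the enclosing functions see only the tail.\<close>

lemma recursive_tl:
  assumes "recursive k f"
  shows "recursive (Suc k) (\<lambda>xs. f (tl xs))"
proof (rule recursive_cong)
  show "recursive (Suc k) (\<lambda>xs. f (map (\<lambda>i. xs ! i) (map Suc [0..<k])))"
    using assms by (intro recursive_reindex) auto
  fix xs :: "nat list"
  assume "length xs = Suc k"
  then have "tl xs = map (\<lambda>i. xs ! i) (map Suc [0..<k])"
    by (intro nth_equalityI) (auto simp: nth_tl)
  then show "f (tl xs) = f (map (\<lambda>i. xs ! i) (map Suc [0..<k]))" by simp
qed

lemma recursive_Suc:
  assumes "recursive k f"
  shows "recursive k (\<lambda>xs. Suc (f xs))"
proof -
  have "computes RSucc xs (Suc (xs ! 0))" if "length xs = Suc 0" for xs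
    using that by (cases xs) (auto intro: computes.succ)
  then have "recursive (Suc 0) (\<lambda>xs. Suc (xs ! 0))" unfolding recursive_def by blast
  then show ?thesis using assms by (rule recursive_comp1)
qed

lemma recursive_const: "recursive k (\<lambda>xs. c)"
proof (induction c)
  case 0
  show ?case unfolding recursive_def by (blast intro: computes.zero)
next
  case (Suc c)
  then show ?case by (rule recursive_Suc)
qed

text \<open>In the step function the counter and the previous value stand before the parameters. Since the
  number of iterations may itself depend on the arguments, the recursion is first shown recursive
  with a free counter, for which \<open>n\<close> is then substituted.\<close>

lemma recursive_rec_nat:
  assumes f: "recursive k f" and n: "recursive k n"
    and g: "recursive (Suc (Suc k)) (\<lambda>ys. g (ys ! 0) (ys ! 1) (tl (tl ys)))"
  shows "recursive k (\<lambda>xs. rec_nat (f xs) (\<lambda>i y. g i y xs) (n xs))"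
proof -
  from f obtain pf where pf: "\<And>xs. length xs = k \<Longrightarrow> computes pf xs (f xs)"
    unfolding recursive_def by blast
  from g obtain pg where pg: "\<And>xs. length xs = Suc (Suc k)
      \<Longrightarrow> computes pg xs (g (xs ! 0) (xs ! 1) (tl (tl xs)))"
    unfolding recursive_def by blast
  have rec: "computes (RPrim pf pg) (m # xs) (rec_nat (f xs) (\<lambda>i y. g i y xs) m)"
    if "length xs = k" for m xs
  proof (induction m)
    case 0
    show ?case using pf[OF that] by (simp add: computes.prim_0)
  next
    case (Suc m)
    show ?case using computes.prim_Suc[OF Suc] pg[of "m # _ # xs"] that by simp
  qed
  have "recursive (Suc k) (\<lambda>ys. rec_nat (f (tl ys)) (\<lambda>i y. g i y (tl ys)) (ys ! 0))"
    unfolding recursive_def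
  proof (intro exI allI impI)
    fix ys :: "nat list"
    assume "length ys = Suc k"
    then show "computes (RPrim pf pg) ys (rec_nat (f (tl ys)) (\<lambda>i y. g i y (tl ys)) (ys ! 0))"
      using rec by (cases ys) auto
  qed
  then have *: "recursive k (\<lambda>xs. (\<lambda>ys. rec_nat (f (tl ys)) (\<lambda>i y. g i y (tl ys)) (ys ! 0))
      (map (\<lambda>f. f xs) (n # map (\<lambda>i xs. xs ! i) [0..<k])))"
    using n by (intro recursive_comp) (auto intro: recursive_nth)
  show ?thesis
  proof (rule recursive_cong[OF *])
    fix xs :: "nat list"
    assume "length xs = k"
    then have "map (\<lambda>f. f xs) (map (\<lambda>i xs. xs ! i) [0..<k]) = xs"
      using map_nth[of xs] by (simp add: comp_def)
    then show "rec_nat (f xs) (\<lambda>i y. g i y xs) (n xs) =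
        (\<lambda>ys. rec_nat (f (tl ys)) (\<lambda>i y. g i y (tl ys)) (ys ! 0))
          (map (\<lambda>f. f xs) (n # map (\<lambda>i xs. xs ! i) [0..<k]))"
      by (simp del: map_map)
  qed
qed

lemma recursive_add:
  assumes "recursive k f" "recursive k g"
  shows "recursive k (\<lambda>xs. f xs + g xs)"
proof -
  have "rec_nat a (\<lambda>i y. Suc y) b = a + b" for a b
    by (induction b) auto
  then show ?thesis
    using recursive_rec_nat[of k f g "\<lambda>i y xs. Suc y"] assms
    by (simp add: recursive_Suc recursive_nth)
qed

lemma recursive_diff:
  assumes "recursive k f" "recursive k g"
  shows "recursive k (\<lambda>xs. f xs - g xs)"
proof -
  have pred: "rec_nat 0 (\<lambda>i y. i) a = a - 1" for a :: nat
    by (cases a) auto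
  have "recursive k' (\<lambda>xs. f' xs - 1)" if "recursive k' f'" for k' f'
    using recursive_rec_nat[of k' "\<lambda>_. 0" f' "\<lambda>i y xs. i"] that
    by (simp add: pred recursive_const recursive_nth)
  moreover have "rec_nat a (\<lambda>i y. y - 1) b = a - b" for a b :: nat
    by (induction b) auto
  ultimately show ?thesis
    using recursive_rec_nat[of k f g "\<lambda>i y xs. y - 1"] assms
    by (simp add: recursive_nth)
qed

lemma recursive_min:
  assumes "recursive k f" "recursive k g"
  shows "recursive k (\<lambda>xs. min (f xs) (g xs))"
proof -
  have "min (f xs) (g xs) = f xs - (f xs - g xs)" for xs by simp
  then show ?thesis using assms by (simp add: recursive_diff)
qed

lemma recursive_max:
  assumes "recursive k f" "recursive k g"
  shows "recursive k (\<lambda>xs. max (f xs) (g xs))"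
proof -
  have "max (f xs) (g xs) = f xs + (g xs - f xs)" for xs by simp
  then show ?thesis using assms by (simp add: recursive_diff recursive_add)
qed

text \<open>A conditional is a recursion that forgets its previous value: it returns the base value exactly
  if it is iterated zero times. The symmetric difference \<open>(f - g) + (g - f)\<close> vanishes iff
  \<open>f = g\<close>.\<close>

lemma recursive_if_eq:
  assumes "recursive k f" "recursive k g" "recursive k s" "recursive k t"
  shows "recursive k (\<lambda>xs. if f xs = g xs then s xs else t xs)"
proof -
  have "rec_nat a (\<lambda>i y. b) n = (if n = 0 then a else b)" for a b n :: nat
    by (cases n) auto
  then have "rec_nat (s xs) (\<lambda>i y. t xs) ((f xs - g xs) + (g xs - f xs)) =
      (if f xs = g xs then s xs else t xs)" for xs by auto
  then show ?thesis
    using recursive_rec_nat[of k s "\<lambda>xs. (f xs - g xs) + (g xs - f xs)" "\<lambda>i y xs. t xs"] assms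
    by (simp add: recursive_diff recursive_add recursive_tl[where f = "\<lambda>ys. t (tl ys)"] recursive_tl)
qed

lemma recursive_sum:
  assumes n: "recursive k n" and f: "recursive (Suc k) (\<lambda>ys. f (ys ! 0) (tl ys))"
  shows "recursive k (\<lambda>xs. \<Sum>i<n xs. f i xs)"
proof -
  \<comment> \<open>the position between the counter and the parameters holds the partial sum\<close>
  have "recursive (Suc (Suc k)) (\<lambda>ys. f (ys ! 0) (tl (tl ys)))"
  proof (rule recursive_cong)
    show "recursive (Suc (Suc k)) (\<lambda>ys. (\<lambda>ys. f (ys ! 0) (tl ys))
        (map (\<lambda>i. ys ! i) (0 # map (\<lambda>i. Suc (Suc i)) [0..<k])))"
      using f by (intro recursive_reindex) auto
    fix ys :: "nat list"
    assume "length ys = Suc (Suc k)"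
    then have "tl (tl ys) = map (\<lambda>i. ys ! i) (map (\<lambda>i. Suc (Suc i)) [0..<k])"
      by (intro nth_equalityI) (auto simp: nth_tl)
    then show "f (ys ! 0) (tl (tl ys)) = (\<lambda>ys. f (ys ! 0) (tl ys))
        (map (\<lambda>i. ys ! i) (0 # map (\<lambda>i. Suc (Suc i)) [0..<k]))" by simp
  qed
  moreover have "rec_nat 0 (\<lambda>i y. y + f i xs) m = (\<Sum>i<m. f i xs)" for m xs
    by (induction m) auto
  ultimately show ?thesis
    using recursive_rec_nat[of k "\<lambda>_. 0" n "\<lambda>i y xs. y + f i xs"] n
    by (simp add: recursive_const recursive_add recursive_nth)
qed

lemma recursive_mult:
  assumes "recursive k f" "recursive k g"
  shows "recursive k (\<lambda>xs. f xs * g xs)"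
  using recursive_sum[of k f "\<lambda>i xs. g xs"] assms by (simp add: recursive_tl)

lemma recursive_power2:
  assumes "recursive k f"
  shows "recursive k (\<lambda>xs. 2 ^ f xs)"
proof -
  have "rec_nat 1 (\<lambda>i y. y + y) a = (2 :: nat) ^ a" for a
    by (induction a) auto
  then show ?thesis
    using recursive_rec_nat[of k "\<lambda>_. 1" f "\<lambda>i y xs. y + y"] assms
    by (simp add: recursive_add recursive_nth recursive_const)
qed

lemma recursive_prod_encode:
  assumes "recursive k f" "recursive k g"
  shows "recursive k (\<lambda>xs. prod_encode (f xs, g xs))"
proof -
  have "triangle m = (\<Sum>i<Suc m. i)" for m
    by (induction m) auto
  then have "prod_encode (a, b) = (\<Sum>i<Suc (a + b). i) + a" for a b
    unfolding prod_encode_def by simp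
  moreover have "recursive k (\<lambda>xs. (\<Sum>i<Suc (f xs + g xs). i) + f xs)"
    using assms by (intro recursive_add recursive_sum recursive_Suc recursive_nth) auto
  ultimately show ?thesis by simp
qed

lemmas recursive_intros =
  recursive_const recursive_Suc recursive_add recursive_diff recursive_min recursive_max
  recursive_mult recursive_if_eq recursive_sum recursive_power2 recursive_prod_encode

text \<open>Distinct argument pairs give distinct entries, so the binary code of the table contains each
  power of two once.\<close>

lemma table_encode_lessThan:
  "table_encode {..<n} f =
     (\<Sum>a<n. \<Sum>b<n. 2 ^ prod_encode (prod_encode (a, b), f a b))"
proof -
  have "inj_on (\<lambda>(a, b). prod_encode (prod_encode (a, b), f a b)) ({..<n} \<times> {..<n})"
    by (auto simp: inj_on_def)
  then show ?thesis
    unfolding table_encode_def set_encode_def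
    by (simp add: sum.reindex sum.cartesian_product case_prod_unfold)
qed

lemma recursive_set_encode_lessThan:
  assumes "recursive k n"
  shows "recursive k (\<lambda>xs. set_encode {..<n xs})"
  unfolding set_encode_def
  using assms by (intro recursive_sum recursive_power2 recursive_nth) auto

text \<open>The outer summation index \<open>a\<close> is pushed first and so ends up behind \<open>b\<close> in the list of
  arguments.\<close>

lemma recursive_table_encode:
  assumes n: "recursive k n"
    and f: "recursive (Suc (Suc k)) (\<lambda>ys. f (ys ! 1) (ys ! 0) (tl (tl ys)))"
  shows "recursive k (\<lambda>xs. table_encode {..<n xs} (\<lambda>a b. f a b xs))"
proof -
  have 1: "recursive (Suc (Suc k)) (\<lambda>ys. tl ys ! 0)"
    by (intro recursive_tl[where f = "\<lambda>ys. ys ! 0"] recursive_nth) simp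
  have 2: "recursive (Suc (Suc k)) (\<lambda>ys. f (tl ys ! 0) (ys ! 0) (tl (tl ys)))"
    by (rule recursive_cong[OF f]) (auto simp: nth_tl)
  show ?thesis
    unfolding table_encode_lessThan
    by (intro recursive_sum n recursive_tl[where f = n] recursive_power2 recursive_prod_encode 1 2
        recursive_nth) auto
qed

section \<open>Separation by truncated codes\<close>

text \<open>Equational laws pass to images of homomorphisms. Hence only the operations of the truncated
  quotient have to be compared with those of the original semiring; its axioms follow.\<close>

lemma semiring_surj_image:
  assumes S: "semiring S" and h: "h \<in> semiring_hom S T" and surj: "h ` carrier S = carrier T"
  shows "semiring T"
proof -
  interpret S: semiring S by fact
  have im: "\<And>x. x \<in> carrier S \<Longrightarrow> h x \<in> carrier T"
    and add: "\<And>x y. x \<in> carrier S \<Longrightarrow> y \<in> carrier S \<Longrightarrow> h x \<oplus>\<^bsub>T\<^esub> h y = h (x \<oplus>\<^bsub>S\<^esub> y)"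
    and mult: "\<And>x y. x \<in> carrier S \<Longrightarrow> y \<in> carrier S \<Longrightarrow> h x \<otimes>\<^bsub>T\<^esub> h y = h (x \<otimes>\<^bsub>S\<^esub> y)"
    and zero: "\<zero>\<^bsub>T\<^esub> = h \<zero>\<^bsub>S\<^esub>" and one: "\<one>\<^bsub>T\<^esub> = h \<one>\<^bsub>S\<^esub>"
    using h surj unfolding semiring_hom_def ring_hom_def by auto
  show ?thesis
    by (intro semiring.intro abelian_monoidI monoidI semiring_axioms.intro; unfold surj[symmetric])
      (auto simp: add mult zero one S.a_ac S.m_assoc S.l_distr S.r_distr)
qed

text \<open>The operations \<open>A\<close> and \<open>B\<close> on codes have to be compatible with truncation at \<open>m\<close>, and this
  may fail for small \<open>m\<close>, for instance if \<open>0\<close> and \<open>1\<close> are identified in \<open>N_bar\<close> but not \<open>\<infinity>\<close>. The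
  infinite elements and the smallest finite one have codes at most \<open>2\<close>, so they are kept apart from
  all others once \<open>3 \<le> m\<close>. Truncating at \<open>code c + 3\<close> rather than at \<open>code c + 1\<close> guarantees this
  for every \<open>c\<close>.\<close>

lemma effectively_separated_by_truncation:
  assumes S: "semiring S" and code: "bij_betw code (carrier S) UNIV"
    and A: "\<And>x y. x \<in> carrier S \<Longrightarrow> y \<in> carrier S \<Longrightarrow> code (x \<oplus>\<^bsub>S\<^esub> y) = A (code x) (code y)"
    and B: "\<And>x y. x \<in> carrier S \<Longrightarrow> y \<in> carrier S \<Longrightarrow> code (x \<otimes>\<^bsub>S\<^esub> y) = B (code x) (code y)"
    and A_trunc: "\<And>m a b. 3 \<le> m \<Longrightarrow> min (A (min a m) (min b m)) m = min (A a b) m"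
    and B_trunc: "\<And>m a b. 3 \<le> m \<Longrightarrow> min (B (min a m) (min b m)) m = min (B a b) m"
    and A_rec: "recursive 2 (\<lambda>xs. A (xs ! 0) (xs ! 1))"
    and B_rec: "recursive 2 (\<lambda>xs. B (xs ! 0) (xs ! 1))"
  shows "effectively_separated S code"
proof -
  interpret S: semiring S by fact
  define h where "h c x = min (code x) (code c + 3)" for c x
  define T :: "'a \<Rightarrow> nat ring" where
    "T c = \<lparr>carrier = {..<code c + 4}, monoid.mult = (\<lambda>a b. min (B a b) (code c + 3)),
       one = h c \<one>\<^bsub>S\<^esub>, ring.zero = h c \<zero>\<^bsub>S\<^esub>, add = (\<lambda>a b. min (A a b) (code c + 3))\<rparr>" for c
  have inj: "inj_on code (carrier S)" and surj: "code ` carrier S = UNIV"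
    using code by (auto simp: bij_betw_def)
  have sep: "separates_at S c (T c) (h c)" if c: "c \<in> carrier S" for c
  proof -
    have hom: "h c \<in> semiring_hom S (T c)"
      by (auto simp: semiring_hom_def ring_hom_def T_def h_def A B A_trunc B_trunc)
    have "h c ` carrier S = (\<lambda>n. min n (code c + 3)) ` code ` carrier S"
      by (auto simp: h_def)
    also have "\<dots> = {..<code c + 4}"
    proof
      show "{..<code c + 4} \<subseteq> (\<lambda>n. min n (code c + 3)) ` code ` carrier S"
      proof
        fix n assume "n \<in> {..<code c + 4}"
        then have "n = min n (code c + 3)" by simp
        then show "n \<in> (\<lambda>n. min n (code c + 3)) ` code ` carrier S"
          unfolding surj by (rule image_eqI) simp
      qed
    qed auto
    finally have "semiring (T c)"
      by (intro semiring_surj_image[OF S hom]) (simp add: T_def)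
    moreover have "{x \<in> carrier S. h c x = h c c} = {c}"
      using c inj by (auto simp: h_def min_def inj_on_def split: if_splits)
    ultimately show ?thesis
      using hom by (simp add: separates_at_def T_def)
  qed
  have bound: "recursive (Suc 0) (\<lambda>xs. xs ! 0 + 4)"
    by (intro recursive_intros recursive_nth) simp
  have trunc: "recursive (Suc (Suc (Suc 0))) (\<lambda>ys. min (F (ys ! 1) (ys ! 0)) (tl (tl ys) ! 0 + 3))"
    if "recursive 2 (\<lambda>xs. F (xs ! 0) (xs ! 1))" for F
    by (intro recursive_min recursive_comp2[OF that] recursive_nth recursive_add recursive_const
        recursive_tl[where f = "\<lambda>ys. tl ys ! 0"] recursive_tl[where f = "\<lambda>ys. ys ! 0"]) auto
  have tables: "\<exists>p. \<forall>c. computes p [code c]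
      (table_encode {..<code c + 4} (\<lambda>a b. min (F a b) (code c + 3)))"
    if "recursive 2 (\<lambda>xs. F (xs ! 0) (xs ! 1))" for F
  proof -
    have "recursive (Suc 0) (\<lambda>xs. table_encode {..<xs ! 0 + 4} (\<lambda>a b. min (F a b) (xs ! 0 + 3)))"
      by (rule recursive_table_encode[OF bound trunc[OF that]])
    then obtain p where "\<And>xs. length xs = Suc 0 \<Longrightarrow> computes p xs
        (table_encode {..<xs ! 0 + 4} (\<lambda>a b. min (F a b) (xs ! 0 + 3)))"
      unfolding recursive_def by blast
    from this[of "[_]"] show ?thesis by auto
  qed
  have "\<exists>p. \<forall>c. computes p [code c] (set_encode {..<code c + 4})"
  proof -
    obtain p where "\<And>xs. length xs = Suc 0 \<Longrightarrow> computes p xs (set_encode {..<xs ! 0 + 4})"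
      using recursive_set_encode_lessThan[OF bound] unfolding recursive_def by blast
    from this[of "[_]"] show ?thesis by auto
  qed
  moreover have "\<exists>p. \<forall>c x. computes p [code c, code x] (h c x)"
  proof -
    have "recursive (Suc (Suc 0)) (\<lambda>xs. min (xs ! 1) (xs ! 0 + 3))"
      by (intro recursive_intros recursive_nth) auto
    then obtain p where "\<And>xs. length xs = Suc (Suc 0) \<Longrightarrow>
        computes p xs (min (xs ! 1) (xs ! 0 + 3))" unfolding recursive_def by blast
    from this[of "[_, _]"] show ?thesis by (auto simp: h_def)
  qed
  ultimately show ?thesis
    unfolding effectively_separated_def
    using S inj sep tables[OF A_rec] tables[OF B_rec]
    by (intro conjI exI[of _ T] exI[of _ h]) (simp_all add: T_def, blast+)
qed

section \<open>Subsemirings\<close>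

text \<open>Conversely, equational laws are reflected by injective homomorphisms.\<close>

lemma semiring_inj_preimage:
  assumes S: "semiring S" and e: "e \<in> semiring_hom R S" and inj: "inj_on e (carrier R)"
    and closed: "\<zero>\<^bsub>R\<^esub> \<in> carrier R" "\<one>\<^bsub>R\<^esub> \<in> carrier R"
      "\<And>x y. x \<in> carrier R \<Longrightarrow> y \<in> carrier R \<Longrightarrow> x \<oplus>\<^bsub>R\<^esub> y \<in> carrier R"
      "\<And>x y. x \<in> carrier R \<Longrightarrow> y \<in> carrier R \<Longrightarrow> x \<otimes>\<^bsub>R\<^esub> y \<in> carrier R"
  shows "semiring R"
proof -
  interpret S: semiring S by fact
  have im: "\<And>x. x \<in> carrier R \<Longrightarrow> e x \<in> carrier S"
    and hom: "\<And>x y. x \<in> carrier R \<Longrightarrow> y \<in> carrier R \<Longrightarrow> e (x \<oplus>\<^bsub>R\<^esub> y) = e x \<oplus>\<^bsub>S\<^esub> e y"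
      "\<And>x y. x \<in> carrier R \<Longrightarrow> y \<in> carrier R \<Longrightarrow> e (x \<otimes>\<^bsub>R\<^esub> y) = e x \<otimes>\<^bsub>S\<^esub> e y"
      "e \<zero>\<^bsub>R\<^esub> = \<zero>\<^bsub>S\<^esub>" "e \<one>\<^bsub>R\<^esub> = \<one>\<^bsub>S\<^esub>"
    using e unfolding semiring_hom_def ring_hom_def by auto
  show ?thesis
    by (intro semiring.intro abelian_monoidI monoidI semiring_axioms.intro;
        (intro closed; assumption)?; rule inj_onD[OF inj])
      (simp_all add: closed hom im S.a_ac S.m_assoc S.l_distr S.r_distr)
qed

text \<open>The finite semiring that separates \<open>e c\<close> in \<open>S\<close> also separates \<open>c\<close> in \<open>R\<close>: by injectivity of
  \<open>e\<close>, pulling back the singleton class of \<open>e c\<close> gives the singleton class of \<open>c\<close>. The programs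
  for \<open>S\<close> become programs for \<open>R\<close> by first translating the codes with \<open>t\<close>.\<close>

lemma effectively_separated_embedding:
  assumes sep: "effectively_separated S codeS" and e: "e \<in> semiring_hom R S"
    and inj: "inj_on e (carrier R)"
    and closed: "\<zero>\<^bsub>R\<^esub> \<in> carrier R" "\<one>\<^bsub>R\<^esub> \<in> carrier R"
      "\<And>x y. x \<in> carrier R \<Longrightarrow> y \<in> carrier R \<Longrightarrow> x \<oplus>\<^bsub>R\<^esub> y \<in> carrier R"
      "\<And>x y. x \<in> carrier R \<Longrightarrow> y \<in> carrier R \<Longrightarrow> x \<otimes>\<^bsub>R\<^esub> y \<in> carrier R"
    and code: "\<And>x. x \<in> carrier R \<Longrightarrow> codeS (e x) = t (codeR x)"
    and t: "recursive (Suc 0) (\<lambda>xs. t (xs ! 0))"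
  shows "effectively_separated R codeR"
proof -
  from sep obtain T :: "'a \<Rightarrow> nat ring" and h p1 p2 p3 p4 where
    S: "semiring S" "inj_on codeS (carrier S)" and
    sep: "\<And>c. c \<in> carrier S \<Longrightarrow> separates_at S c (T c) (h c)" and
    p: "\<And>c. c \<in> carrier S \<Longrightarrow> computes p1 [codeS c] (set_encode (carrier (T c)))"
      "\<And>c. c \<in> carrier S \<Longrightarrow> computes p2 [codeS c] (table_encode (carrier (T c)) (add (T c)))"
      "\<And>c. c \<in> carrier S \<Longrightarrow> computes p3 [codeS c] (table_encode (carrier (T c)) (mult (T c)))"
      "\<And>c x. c \<in> carrier S \<Longrightarrow> x \<in> carrier S \<Longrightarrow> computes p4 [codeS c, codeS x] (h c x)"
    unfolding effectively_separated_def by blast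
  have im: "\<And>x. x \<in> carrier R \<Longrightarrow> e x \<in> carrier S"
    using e unfolding semiring_hom_def ring_hom_def by auto
  have R: "semiring R" using S(1) e inj closed by (rule semiring_inj_preimage)
  have inj_code: "inj_on codeR (carrier R)"
    using S(2) inj code im by (metis inj_on_def)
  have sepR: "separates_at R c (T (e c)) (\<lambda>x. h (e c) (e x))" if c: "c \<in> carrier R" for c
  proof -
    have hom: "(\<lambda>x. h (e c) (e x)) \<in> semiring_hom R (T (e c))"
      using sep[OF im[OF c]] e im unfolding separates_at_def semiring_hom_def ring_hom_def
      by (simp add: Pi_iff)
    have "{x \<in> carrier S. h (e c) x = h (e c) (e c)} = {e c}"
      using sep[OF im[OF c]] unfolding separates_at_def by blast
    then have "{x \<in> carrier R. h (e c) (e x) = h (e c) (e c)} = {c}"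
      using c im inj by (auto simp: inj_on_def)
    with hom show ?thesis
      using sep[OF im[OF c]] by (simp add: separates_at_def)
  qed
  from t obtain pt where pt: "\<And>xs. length xs = Suc 0 \<Longrightarrow> computes pt xs (t (xs ! 0))"
    unfolding recursive_def by blast
  have 1: "computes (RComp q [pt]) [codeR c] y"
    if "computes q [codeS (e c)] y" "c \<in> carrier R" for q c y
    using that pt[of "[codeR c]"] by (intro computes.comp[of _ _ "[codeS (e c)]"]) (auto simp: code)
  have arg: "computes (RComp pt [RProj i]) xs (t (xs ! i))" if "i < length xs" for i xs
    using that pt[of "[xs ! i]"] by (intro computes.comp[of _ _ "[xs ! i]"]) (auto intro: computes.proj)
  have 2: "computes (RComp p4 [RComp pt [RProj 0], RComp pt [RProj 1]])
      [codeR c, codeR x] (h (e c) (e x))" if "c \<in> carrier R" "x \<in> carrier R" for c x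
    using arg[of 0 "[codeR c, codeR x]"] arg[of 1 "[codeR c, codeR x]"] that p(4)[of "e c" "e x"] im
    by (intro computes.comp[of _ _ "[codeS (e c), codeS (e x)]"]) (auto simp: code)
  show ?thesis
    unfolding effectively_separated_def
    by (intro conjI ballI exI[of _ "\<lambda>c. T (e c)"] exI[of _ "\<lambda>c x. h (e c) (e x)"]
        exI[of _ "RComp _ [pt]"] exI[of _ "RComp p4 [RComp pt [RProj 0], RComp pt [RProj 1]]"])
      (assumption | rule R inj_code sepR 1 2 p im)+
qed

section \<open>The six semirings\<close>

text \<open>In both \<open>L_semiring\<close> and \<open>N_max_bar\<close> the semiring multiplication is an addition in which the
  element of code \<open>0\<close> absorbs everything, the element of code \<open>1\<close> absorbs all finite elements, and
  a finite \<open>n\<close> has code \<open>n + 2\<close>. On codes the two multiplications are therefore the same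
  function.\<close>

definition code_plus2 :: "nat \<Rightarrow> nat \<Rightarrow> nat" where
  "code_plus2 a b = (if a = 0 then 0 else if b = 0 then 0 else
     if a = 1 then 1 else if b = 1 then 1 else a + b - 2)"

lemma recursive_code_plus2:
  "recursive 2 (\<lambda>xs. code_plus2 (xs ! 0) (xs ! 1))"
  unfolding code_plus2_def by (intro recursive_intros recursive_nth) auto

lemma code_plus2_trunc:
  "3 \<le> m \<Longrightarrow> min (code_plus2 (min a m) (min b m)) m = min (code_plus2 a b) m"
  unfolding code_plus2_def by (auto simp: min_def)

lemma semiring_on_UNIV:
  fixes f g :: "'a \<Rightarrow> 'a \<Rightarrow> 'a"
  assumes f: "\<And>x y z. f (f x y) z = f x (f y z)" "\<And>x y. f x y = f y x" "\<And>x. f z x = x"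
    and g: "\<And>x y z. g (g x y) z = g x (g y z)" "\<And>x y. g x y = g y x"
      "\<And>x. g u x = x" "\<And>x. g z x = z"
    and distr: "\<And>x y z. g x (f y z) = f (g x y) (g x z)"
  shows "semiring \<lparr>carrier = UNIV, monoid.mult = g, one = u, ring.zero = z, add = f\<rparr>"
proof -
  have "g x u = x" "g x z = z" "g (f x y) w = f (g x w) (g y w)" for x y w
    using g distr by metis+
  then show ?thesis
    by (intro semiring.intro abelian_monoidI monoidI semiring_axioms.intro) 
      (auto simp: f(1,3) g(1,3,4) distr intro: f(2))
qed

lemma plus_lnat_simps: "plus_lnat a LInfty = LInfty" "plus_lnat LInfty a = LInfty"
  "plus_lnat (LFin n) LOmega = LOmega" "plus_lnat LOmega (LFin n) = LOmega"
  "plus_lnat LOmega LOmega = LOmega"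
  by (cases a; auto simp: max_def)+

lemma semiring_L: "semiring L_semiring"
proof -
  have assoc: "plus_lnat (plus_lnat x y) z = plus_lnat x (plus_lnat y z)" for x y z
    by (cases x; cases y; cases z) (auto simp: plus_lnat_simps max_def)
  have comm: "plus_lnat x y = plus_lnat y x" for x y
    by (cases x; cases y) (auto simp: plus_lnat_simps)
  have distr: "plus_lnat x (min y z) = min (plus_lnat x y) (plus_lnat x z)" for x y z
    by (cases x; cases y; cases z) (auto simp: plus_lnat_simps min_def max_def)
  have neutral: "min LInfty x = x" "plus_lnat (LFin 0) x = x" for x
    by (cases x; auto simp: min_def max_def)+
  show ?thesis
    unfolding L_semiring_def
    by (rule semiring_on_UNIV)
      (rule min.assoc min.commute assoc comm distr neutral plus_lnat_simps)+
qed

text \<open>The infinite elements are the largest ones but have the smallest codes, so the minimum of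
  \<open>L_semiring\<close> is not the minimum of the codes.\<close>

definition code_lnat_min :: "nat \<Rightarrow> nat \<Rightarrow> nat" where
  "code_lnat_min a b = (if a = 0 then b else if b = 0 then a else
     if a = 1 then b else if b = 1 then a else min a b)"

lemma effectively_separated_L: "effectively_separated L_semiring code_lnat"
proof (rule effectively_separated_by_truncation[where A = code_lnat_min and B = code_plus2])
  show "bij_betw code_lnat (carrier L_semiring) UNIV"
  proof (rule bij_betwI')
    fix n
    have "n = code_lnat (if n = 0 then LInfty else if n = 1 then LOmega else LFin (n - 2))"
      by (auto simp: code_lnat_def)
    then show "\<exists>x\<in>carrier L_semiring. n = code_lnat x" by (auto simp: L_semiring_def)
  qed (auto simp: code_lnat_def split: lnat.splits)
  show "code_lnat (x \<oplus>\<^bsub>L_semiring\<^esub> y) = code_lnat_min (code_lnat x) (code_lnat y)" for x y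
    by (cases x; cases y) (auto simp: code_lnat_def L_semiring_def code_lnat_min_def min_def)
  show "code_lnat (x \<otimes>\<^bsub>L_semiring\<^esub> y) = code_plus2 (code_lnat x) (code_lnat y)" for x y
    by (cases x; cases y)
      (auto simp: code_lnat_def L_semiring_def code_plus2_def plus_lnat_simps)
  show "min (code_lnat_min (min a m) (min b m)) m = min (code_lnat_min a b) m" if "3 \<le> m"
    for a b m
    using that unfolding code_lnat_min_def by (auto simp: min_def)
  show "recursive 2 (\<lambda>xs. code_lnat_min (xs ! 0) (xs ! 1))"
    unfolding code_lnat_min_def by (intro recursive_intros recursive_nth) auto
qed (simp_all add: semiring_L code_plus2_trunc recursive_code_plus2[simplified])

lemma effectively_separated_N_min: "effectively_separated N_min code_enat"
proof (rule effectively_separated_embedding[OF effectively_separated_L])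
  let ?e = "\<lambda>a. case a of enat n \<Rightarrow> LFin n | \<infinity> \<Rightarrow> LInfty"
  have "?e (a + b) = plus_lnat (?e a) (?e b)" "?e (min a b) = min (?e a) (?e b)" for a b
    by (cases a; cases b; simp add: min_def)+
  then show "?e \<in> semiring_hom N_min L_semiring"
    by (simp add: semiring_hom_def ring_hom_def N_min_def L_semiring_def zero_enat_def)
  show "inj_on ?e (carrier N_min)"
    by (auto simp: inj_on_def split: enat.splits)
  show "code_lnat (?e x) = (if code_enat x = 0 then 0 else Suc (code_enat x))" for x
    by (simp add: code_lnat_def code_enat_def split: enat.splits)
  show "recursive (Suc 0) (\<lambda>xs. if xs ! 0 = 0 then 0 else Suc (xs ! 0))"
    by (intro recursive_intros recursive_nth) auto
qed (simp_all add: N_min_def)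

lemma semiring_N_max_bar: "semiring N_max_bar"
proof -
  have assoc: "plus_bar (plus_bar x y) z = plus_bar x (plus_bar y z)" for x y z
    by (cases x; cases y; cases z) (auto simp: plus_bar_def)
  have comm: "plus_bar x y = plus_bar y x" for x y
    by (cases x; cases y) (auto simp: plus_bar_def)
  have distr: "plus_bar x (max y z) = max (plus_bar x y) (plus_bar x z)" for x y z
    by (cases x; cases y; cases z) (auto simp: plus_bar_def)
  have neutral: "max Minf x = x" "plus_bar (Fin 0) x = x" "plus_bar Minf x = Minf" for x
    by (cases x; auto simp: plus_bar_def)+
  show ?thesis
    unfolding N_max_bar_def
    by (rule semiring_on_UNIV) (rule max.assoc max.commute assoc comm distr neutral)+
qed

definition code_extended_max :: "nat \<Rightarrow> nat \<Rightarrow> nat" where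
  "code_extended_max a b = (if a = 1 then 1 else if b = 1 then 1 else max a b)"

lemma effectively_separated_N_max_bar: "effectively_separated N_max_bar code_extended"
proof (rule effectively_separated_by_truncation[where A = code_extended_max and B = code_plus2])
  show "bij_betw code_extended (carrier N_max_bar) UNIV"
  proof (rule bij_betwI')
    fix n
    have "n = code_extended (if n = 0 then Minf else if n = 1 then Pinf else Fin (n - 2))"
      by (auto simp: code_extended_def)
    then show "\<exists>x\<in>carrier N_max_bar. n = code_extended x" by (auto simp: N_max_bar_def)
  qed (auto simp: code_extended_def split: extended.splits)
  show "code_extended (x \<oplus>\<^bsub>N_max_bar\<^esub> y) = code_extended_max (code_extended x) (code_extended y)"
    for x y
    by (cases x; cases y) (auto simp: code_extended_def N_max_bar_def code_extended_max_def)
  show "code_extended (x \<otimes>\<^bsub>N_max_bar\<^esub> y) = code_plus2 (code_extended x) (code_extended y)" for x y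
    by (cases x; cases y)
      (auto simp: code_extended_def N_max_bar_def code_plus2_def plus_bar_def)
  show "min (code_extended_max (min a m) (min b m)) m = min (code_extended_max a b) m" if "3 \<le> m"
    for a b m
    using that unfolding code_extended_max_def by (auto simp: min_def max_def)
  show "recursive 2 (\<lambda>xs. code_extended_max (xs ! 0) (xs ! 1))"
    unfolding code_extended_max_def by (intro recursive_intros recursive_nth) auto
qed (simp_all add: semiring_N_max_bar code_plus2_trunc recursive_code_plus2[simplified])

lemma effectively_separated_N_max: "effectively_separated N_max code_extended"
proof (rule effectively_separated_embedding[OF effectively_separated_N_max_bar])
  have *: "x + y = plus_bar x y" "plus_bar x y \<noteq> Pinf" if "x \<noteq> Pinf" "y \<noteq> Pinf"
    for x y :: "nat extended"
    using that by (cases x; cases y; simp add: plus_bar_def)+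
  show "id \<in> semiring_hom N_max N_max_bar"
    by (simp add: * semiring_hom_def ring_hom_def N_max_def N_max_bar_def)
  show "x \<otimes>\<^bsub>N_max\<^esub> y \<in> carrier N_max" if "x \<in> carrier N_max" "y \<in> carrier N_max" for x y
    using that by (simp add: * N_max_def)
  show "recursive (Suc 0) (\<lambda>xs. id (xs ! 0))"
    unfolding id_def by (rule recursive_nth) simp
qed (auto simp: N_max_def max_def)

lemma semiring_N_bar: "semiring N_bar"
  unfolding N_bar_def
  by (intro semiring_on_UNIV) (simp_all add: algebra_simps)

definition code_enat_plus :: "nat \<Rightarrow> nat \<Rightarrow> nat" where
  "code_enat_plus a b = (if a = 0 then 0 else if b = 0 then 0 else a + b - 1)"

definition code_enat_times :: "nat \<Rightarrow> nat \<Rightarrow> nat" where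
  "code_enat_times a b = (if a = 1 then 1 else if b = 1 then 1 else
     if a = 0 then 0 else if b = 0 then 0 else Suc ((a - 1) * (b - 1)))"

text \<open>The code of a finite \<open>n\<close> is \<open>n + 1\<close>, so a code \<open>\<ge> m\<close> stands for a number \<open>\<ge> m - 1\<close>. Multiplied by
  a finite nonzero number it stays \<open>\<ge> m - 1\<close>, whether or not it was truncated before; multiplied
  by \<open>0\<close> or \<open>\<infinity>\<close> it gives the same result as every other nonzero number.\<close>

lemma code_enat_times_trunc:
  assumes "3 \<le> m"
  shows "min (code_enat_times (min a m) (min b m)) m = min (code_enat_times a b) m"
proof -
  have big: "m \<le> Suc ((a - 1) * (b - 1))" if "m \<le> a" "2 \<le> b" for a b
    using mult_le_mono[of "m - 1" "a - 1" 1 "b - 1"] that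
    by (simp add: le_diff_conv)
  show ?thesis
  proof (cases "a < 2 \<or> b < 2 \<or> a \<le> m \<and> b \<le> m")
    case True
    then show ?thesis using assms
      by (auto simp: code_enat_times_def min_def less_2_cases_iff)
  next
    case False
    then have "m \<le> Suc ((a - 1) * (b - 1))" "m \<le> Suc ((min a m - 1) * (min b m - 1))"
      using big[of a b] big[of b a] big[of "min a m" "min b m"] big[of "min b m" "min a m"] assms
      by (auto simp: mult.commute)
    moreover have "code_enat_times x y = Suc ((x - 1) * (y - 1))" if "2 \<le> x" "2 \<le> y" for x y
      using that by (simp add: code_enat_times_def)
    ultimately show ?thesis
      using False assms by simp
  qed
qed

lemma effectively_separated_N_bar: "effectively_separated N_bar code_enat"
proof (rule effectively_separated_by_truncation[where A = code_enat_plus and B = code_enat_times])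
  show "bij_betw code_enat (carrier N_bar) UNIV"
  proof (rule bij_betwI')
    fix n
    have "n = code_enat (if n = 0 then \<infinity> else enat (n - 1))"
      by (auto simp: code_enat_def)
    then show "\<exists>x\<in>carrier N_bar. n = code_enat x" by (auto simp: N_bar_def)
  qed (auto simp: code_enat_def split: enat.splits)
  show "code_enat (x \<oplus>\<^bsub>N_bar\<^esub> y) = code_enat_plus (code_enat x) (code_enat y)" for x y
    by (cases x; cases y) (auto simp: code_enat_def N_bar_def code_enat_plus_def)
  show "code_enat (x \<otimes>\<^bsub>N_bar\<^esub> y) = code_enat_times (code_enat x) (code_enat y)" for x y
    by (cases x; cases y) (auto simp: code_enat_def N_bar_def code_enat_times_def zero_enat_def)
  show "min (code_enat_plus (min a m) (min b m)) m = min (code_enat_plus a b) m" if "3 \<le> m"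
    for a b m
    using that unfolding code_enat_plus_def by (auto simp: min_def)
  show "recursive 2 (\<lambda>xs. code_enat_plus (xs ! 0) (xs ! 1))"
    unfolding code_enat_plus_def by (intro recursive_intros recursive_nth) auto
  show "recursive 2 (\<lambda>xs. code_enat_times (xs ! 0) (xs ! 1))"
    unfolding code_enat_times_def by (intro recursive_intros recursive_nth) auto
qed (simp_all add: semiring_N_bar code_enat_times_trunc)

lemma effectively_separated_N_nat: "effectively_separated N_nat id"
proof (rule effectively_separated_embedding[OF effectively_separated_N_bar])
  show "enat \<in> semiring_hom N_nat N_bar"
    by (simp add: semiring_hom_def ring_hom_def N_nat_def N_bar_def zero_enat_def one_enat_def)
  show "code_enat (enat x) = Suc (id x)" for x by (simp add: code_enat_def)
  show "recursive (Suc 0) (\<lambda>xs. Suc (xs ! 0))"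
    by (intro recursive_Suc recursive_nth) simp
qed (simp_all add: N_nat_def inj_on_def)

theorem proposition2:
  shows "effectively_separated N_min code_enat \<and>
         effectively_separated N_max code_extended \<and>
         effectively_separated N_max_bar code_extended \<and>
         effectively_separated L_semiring code_lnat \<and>
         effectively_separated N_nat (id :: nat \<Rightarrow> nat) \<and>
         effectively_separated N_bar code_enat"
  using effectively_separated_N_min effectively_separated_N_max effectively_separated_N_max_bar
    effectively_separated_L effectively_separated_N_nat effectively_separated_N_bar by simp

end
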